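(* Let $R$ be a non-singular, irreducible, aperiodic, positive recurrent homogeneous random walk in the quarter-plane, with interior transition probabilities $p_{s,t}$ and axis transition probabilities $h_s$, $v_t$. Let $\Gamma\subset U=(0,1)^2$ with $|\Gamma|=\infty$ be such that for any $(\rho,\sigma)\in\Gamma$ there exists $(w,v)\in\mathbb{N}^2$ with $\tilde\rho^{w}\tilde\sigma^{v}\neq\rho^w\sigma^v$ for all $(\tilde\rho,\tilde\sigma)\in\Gamma\setminus\{(\rho,\sigma)\}$. Suppose that a measure induced by $\Gamma$, i.e. $m(i,j)=\sum_{(\rho,\sigma)\in\Gamma}\alpha(\rho,\sigma)\rho^i\sigma^j$ with $\alpha(\rho,\sigma)\in\mathbb{R}\setminus\{0\}$ for all $(\rho,\sigma)\in\Gamma$ and $\sum_{(\rho,\sigma)\in\Gamma}|\alpha(\rho,\sigma)|\frac{1}{1-\rho}\frac{1}{1-\sigma}<\infty$, is the invariant measure of $R$. Let $\{\Gamma_k^g\}_{k=1}^{G[\Gamma]}$ be the maximal uncoupled partition of $\Gamma$. Then $|\Gamma_k^g|=\infty$ for all $k=1,2,\dots,G[\Gamma]$, and $G[\Gamma]<\infty$; i.e. $\Gamma$ is the union of finitely many pairwise-coupled sets, each with countably infinite cardinality.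
   Context: Notation: $\mathbb{N}_0=\{0,1,2,\dots\}$, $\mathbb{N}=\{1,2,\dots\}$. Random walk. $R$ is a discrete-time Markov chain on $S=\{(i,j): i,j\in\mathbb{N}_0\}$; $p_{s,t}(i,j)$ is the probability of going from $(i,j)$ to $(i+s,j+t)$, and it is zero if $|s|>1$ or $|t|>1$. The interior is $\{i>0,j>0\}$, the horizontal axis is $\{i>0,j=0\}$, the vertical axis is $\{i=0,j>0\}$. The walk is homogeneous: for each two states $(i,j),(k,l)$ both in the interior (respectively both on the horizontal axis, both on the vertical axis), $p_{s,t}(i,j)=p_{s,t}(k,l)$ and $p_{s,t}(i-s,j-t)=p_{s,t}(k-s,l-t)$ for all $s,t\in\{-1,0,1\}$. For $i,j>0$ write $p_{s,t}=p_{s,t}(i,j)$, $h_s=p_{s,0}(i,0)$, $v_t=p_{0,t}(0,j)$. Consequently transitions from the horizontal axis into the row $j=1$ have probabilities $p_{s,1}$, transitions from the vertical axis into the column $i=1$ have probabilities $p_{1,t}$, and from the origin one goes to $(1,0),(0,1),(1,1)$ with probabilities $h_1,v_1,p_{1,1}$. Invariant measure. A positive finite measure $m$ on $S$ is invariant if it satisfies the balance equations, for all $i,j>0$: $m(i,j)=\sum_{s,t=-1}^{1}m(i-s,j-t)p_{s,t}$; $m(i,0)=\sum_{s=-1}^1 m(i-s,1)p_{s,-1}+\sum_{s=-1}^1 m(i-s,0)h_s$; $m(0,j)=\sum_{t=-1}^1 m(1,j-t)p_{-1,t}+\sum_{t=-1}^1 m(0,j-t)v_t$ (balance at the origin is implied).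 Curve. $Q(x,y)=xy\big(\sum_{s=-1}^{1}\sum_{t=-1}^{1}x^{-s}y^{-t}p_{s,t}-1\big)$, a polynomial; $Q$ also denotes $\{(x,y)\in\mathbb{R}^2: Q(x,y)=0\}$; $Q^+=Q\cap[0,\infty)^2$; $U=(0,1)^2$; $Q_U^+=Q^+\cap U$. $R$ is singular if the polynomial $Q(x,y)$ is reducible or of degree $1$ in at least one of the variables. Uncoupled partitions. A partition $\{\Gamma_1,\Gamma_2,\dots\}$ of $\Gamma$ is horizontally uncoupled if $(\rho,\sigma)\in\Gamma_p$ and $(\tilde\rho,\tilde\sigma)\in\Gamma_q$ with $p\neq q$ implies $\tilde\rho\neq\rho$; vertically uncoupled if this implies $\tilde\sigma\neq\sigma$; uncoupled if it is both horizontally and vertically uncoupled. The maximal uncoupled partition is the (unique) uncoupled partition with the largest number of sets (i.e. the finest one: its sets are the classes of the equivalence relation on $\Gamma$ generated by having a common first coordinate or a common second coordinate). It is denoted $\{\Gamma_k^g\}_{k=1}^{G[\Gamma]}$, where $G[\Gamma]$, its number of sets, is a priori allowed to be infinite. A set $\Gamma'\subset Q_U^+$ is pairwise-coupled if its maximal uncoupled partition contains only one set. *)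

theory Defs
  imports
    "HOL-Probability.Probability"
    "HOL-Computational_Algebra.Polynomial"
    "HOL-Library.Disjoint_Sets"
begin

section \<open>Discrete-time Markov chains given by their transition kernel\<close>

primrec n_step :: "('a \<Rightarrow> 'a pmf) \<Rightarrow> nat \<Rightarrow> 'a \<Rightarrow> 'a pmf" where
  "n_step K 0 x = return_pmf x"
| "n_step K (Suc n) x = bind_pmf (K x) (n_step K n)"

definition irreducible_chain :: "('a \<Rightarrow> 'a pmf) \<Rightarrow> bool" where
  "irreducible_chain K \<longleftrightarrow> (\<forall>x y. \<exists>n. pmf (n_step K n x) y > 0)"

definition aperiodic_chain :: "('a \<Rightarrow> 'a pmf) \<Rightarrow> bool" where
  "aperiodic_chain K \<longleftrightarrow> (\<forall>x. Gcd {n. n > 0 \<and> pmf (n_step K n x) x > 0} = 1)"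

(* first_passage K n x y is the probability that the chain started in x visits y, at a
   strictly positive time, for the first time at time n + 1. *)
primrec first_passage :: "('a \<Rightarrow> 'a pmf) \<Rightarrow> nat \<Rightarrow> 'a \<Rightarrow> 'a \<Rightarrow> real" where
  "first_passage K 0 x y = pmf (K x) y"
| "first_passage K (Suc n) x y =
     measure_pmf.expectation (K x) (\<lambda>z. if z = y then 0 else first_passage K n z y)"

(* The return time is almost surely finite and has finite mean. *)
definition positive_recurrent_chain :: "('a \<Rightarrow> 'a pmf) \<Rightarrow> bool" where
  "positive_recurrent_chain K \<longleftrightarrow>
     (\<forall>x. (\<lambda>n. first_passage K n x x) sums 1 \<and>
          summable (\<lambda>n. real (Suc n) * first_passage K n x x))"


section \<open>Homogeneous random walks in the quarter-plane\<close>

type_synonym state = "nat \<times> nat"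

type_synonym walk = "state \<Rightarrow> state pmf"

(* step_prob R s t i j is p_{s,t}(i,j); it is 0 when (i,j) or (i+s,j+t) lies outside the
   quarter-plane. *)
definition step_prob :: "walk \<Rightarrow> int \<Rightarrow> int \<Rightarrow> int \<Rightarrow> int \<Rightarrow> real" where
  "step_prob R s t i j =
     (if 0 \<le> i \<and> 0 \<le> j \<and> 0 \<le> i + s \<and> 0 \<le> j + t
      then pmf (R (nat i, nat j)) (nat (i + s), nat (j + t)) else 0)"

definition interior_states :: "(int \<times> int) set" where
  "interior_states = {(i, j). i > 0 \<and> j > 0}"

definition horizontal_axis :: "(int \<times> int) set" where
  "horizontal_axis = {(i, j). i > 0 \<and> j = 0}"

definition vertical_axis :: "(int \<times> int) set" where
  "vertical_axis = {(i, j). i = 0 \<and> j > 0}"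

definition homogeneous_walk :: "walk \<Rightarrow> bool" where
  "homogeneous_walk R \<longleftrightarrow>
     (\<forall>s t i j. \<bar>s\<bar> > 1 \<or> \<bar>t\<bar> > 1 \<longrightarrow> step_prob R s t i j = 0) \<and>
     (\<forall>A \<in> {interior_states, horizontal_axis, vertical_axis}.
        \<forall>(i, j) \<in> A. \<forall>(k, l) \<in> A. \<forall>s \<in> {-1..1}. \<forall>t \<in> {-1..1}.
          step_prob R s t i j = step_prob R s t k l \<and>
          step_prob R s t (i - s) (j - t) = step_prob R s t (k - s) (l - t))"

(* For a homogeneous walk the choice of the reference states (1,1), (1,0), (0,1) is
   immaterial. *)
definition p_int :: "walk \<Rightarrow> int \<Rightarrow> int \<Rightarrow> real" where
  "p_int R s t = step_prob R s t 1 1"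

definition p_hor :: "walk \<Rightarrow> int \<Rightarrow> real" where
  "p_hor R s = step_prob R s 0 1 0"

definition p_ver :: "walk \<Rightarrow> int \<Rightarrow> real" where
  "p_ver R t = step_prob R 0 t 0 1"

definition balance_equations :: "walk \<Rightarrow> (state \<Rightarrow> real) \<Rightarrow> bool" where
  "balance_equations R m \<longleftrightarrow>
     (\<forall>i>0. \<forall>j>0. m (i, j) =
        (\<Sum>s\<in>{-1..1}. \<Sum>t\<in>{-1..1}. m (nat (int i - s), nat (int j - t)) * p_int R s t)) \<and>
     (\<forall>i>0. m (i, 0) =
        (\<Sum>s\<in>{-1..1}. m (nat (int i - s), 1) * p_int R s (-1)) +
        (\<Sum>s\<in>{-1..1}. m (nat (int i - s), 0) * p_hor R s)) \<and>
     (\<forall>j>0. m (0, j) =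
        (\<Sum>t\<in>{-1..1}. m (1, nat (int j - t)) * p_int R (-1) t) +
        (\<Sum>t\<in>{-1..1}. m (0, nat (int j - t)) * p_ver R t))"

(* A positive finite measure, given by its point masses: nonnegative, nonzero, finite total
   mass. *)
definition invariant_measure :: "walk \<Rightarrow> (state \<Rightarrow> real) \<Rightarrow> bool" where
  "invariant_measure R m \<longleftrightarrow>
     (\<forall>x. m x \<ge> 0) \<and> (\<exists>x. m x > 0) \<and> m summable_on UNIV \<and> balance_equations R m"


section \<open>The kernel polynomial and its curve\<close>

(* Elements of R[x][y]: the outer variable is y, the coefficients are polynomials in x. *)
definition kernel_poly :: "walk \<Rightarrow> real poly poly" where
  "kernel_poly R =
     (\<Sum>s\<in>{-1..1}. \<Sum>t\<in>{-1..1}. monom (monom (p_int R s t) (nat (1 - s))) (nat (1 - t)))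
     - monom (monom 1 1) 1"

definition eval2 :: "real poly poly \<Rightarrow> real \<Rightarrow> real \<Rightarrow> real" where
  "eval2 q x y = poly (poly q [:y:]) x"

lemma eval2_kernel_poly:
  assumes "x \<noteq> 0" "y \<noteq> 0"
  shows "eval2 (kernel_poly R) x y =
    x * y * ((\<Sum>s\<in>{-1..1}. \<Sum>t\<in>{-1..1}. x powi (-s) * y powi (-t) * p_int R s t) - 1)"
proof -
  have pow: "z ^ nat (1 - s) = z * z powi (-s)" if "z \<noteq> 0" "s \<in> {-1..1}" for z :: real and s
  proof -
    have "z ^ nat (1 - s) = z powi (1 + - s)" using that(2) by (simp add: power_int_def)
    also have "\<dots> = z * z powi (-s)" using that(1) by (subst power_int_add) auto
    finally show ?thesis .
  qed
  have "eval2 (kernel_poly R) x y =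
      (\<Sum>s\<in>{-1..1}. \<Sum>t\<in>{-1..1}. p_int R s t * x ^ nat (1 - s) * y ^ nat (1 - t)) - x * y"
    by (simp add: eval2_def kernel_poly_def poly_monom poly_sum poly_power)
  also have "(\<Sum>s\<in>{-1..1}. \<Sum>t\<in>{-1..1}. p_int R s t * x ^ nat (1 - s) * y ^ nat (1 - t)) =
      (\<Sum>s\<in>{-1..1}. \<Sum>t\<in>{-1..1}. x * y * (x powi (-s) * y powi (-t) * p_int R s t))"
    by (intro sum.cong refl) (simp only: pow[OF assms(1)] pow[OF assms(2)] mult_ac)
  finally show ?thesis by (simp add: sum_distrib_left right_diff_distrib)
qed

definition degree_x :: "real poly poly \<Rightarrow> nat" where
  "degree_x q = (MAX k\<in>{..degree q}. degree (coeff q k))"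

definition degree_y :: "real poly poly \<Rightarrow> nat" where
  "degree_y q = degree q"

definition singular_walk :: "walk \<Rightarrow> bool" where
  "singular_walk R \<longleftrightarrow>
     \<not> irreducible (kernel_poly R) \<or> degree_x (kernel_poly R) = 1 \<or> degree_y (kernel_poly R) = 1"

definition curve :: "walk \<Rightarrow> (real \<times> real) set" where
  "curve R = {(x, y). eval2 (kernel_poly R) x y = 0}"

definition curve_nonneg :: "walk \<Rightarrow> (real \<times> real) set" where
  "curve_nonneg R = curve R \<inter> {0..} \<times> {0..}"

definition unit_square :: "(real \<times> real) set" where
  "unit_square = {0<..<1} \<times> {0<..<1}"

definition curve_unit :: "walk \<Rightarrow> (real \<times> real) set" where
  "curve_unit R = curve_nonneg R \<inter> unit_square"


section \<open>Uncoupled partitions\<close>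

definition horizontally_uncoupled :: "(real \<times> real) set set \<Rightarrow> bool" where
  "horizontally_uncoupled P \<longleftrightarrow>
     (\<forall>A\<in>P. \<forall>B\<in>P. A \<noteq> B \<longrightarrow> (\<forall>(\<rho>, \<sigma>)\<in>A. \<forall>(\<rho>', \<sigma>')\<in>B. \<rho>' \<noteq> \<rho>))"

definition vertically_uncoupled :: "(real \<times> real) set set \<Rightarrow> bool" where
  "vertically_uncoupled P \<longleftrightarrow>
     (\<forall>A\<in>P. \<forall>B\<in>P. A \<noteq> B \<longrightarrow> (\<forall>(\<rho>, \<sigma>)\<in>A. \<forall>(\<rho>', \<sigma>')\<in>B. \<sigma>' \<noteq> \<sigma>))"

definition uncoupled_partition :: "(real \<times> real) set \<Rightarrow> (real \<times> real) set set \<Rightarrow> bool" where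
  "uncoupled_partition \<Gamma> P \<longleftrightarrow>
     partition_on \<Gamma> P \<and> horizontally_uncoupled P \<and> vertically_uncoupled P"

definition coupling :: "(real \<times> real) set \<Rightarrow> ((real \<times> real) \<times> (real \<times> real)) set" where
  "coupling \<Gamma> = {(a, b). a \<in> \<Gamma> \<and> b \<in> \<Gamma> \<and> (fst a = fst b \<or> snd a = snd b)}"

(* The lemmas below show that this is the uncoupled partition with the largest number of
   sets, and the finest one when that number is infinite. *)
definition maximal_uncoupled_partition :: "(real \<times> real) set \<Rightarrow> (real \<times> real) set set" where
  "maximal_uncoupled_partition \<Gamma> = \<Gamma> // (coupling \<Gamma>)\<^sup>*"

lemma coupling_class_subset: "a \<in> \<Gamma> \<Longrightarrow> (coupling \<Gamma>)\<^sup>* `` {a} \<subseteq> \<Gamma>"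
proof
  fix b assume "a \<in> \<Gamma>" "b \<in> (coupling \<Gamma>)\<^sup>* `` {a}"
  then have "(a, b) \<in> (coupling \<Gamma>)\<^sup>*" by simp
  then show "b \<in> \<Gamma>" using \<open>a \<in> \<Gamma>\<close>
    by (induction rule: rtrancl_induct) (auto simp: coupling_def)
qed

lemma equiv_coupling: "equiv UNIV ((coupling \<Gamma>)\<^sup>*)"
proof (rule equivI)
  have "sym (coupling \<Gamma>)" by (auto simp: sym_def coupling_def)
  then show "sym ((coupling \<Gamma>)\<^sup>*)" by (rule sym_rtrancl)
qed (auto simp: refl_rtrancl trans_rtrancl)

lemma coupled_same_class:
  assumes "A \<in> maximal_uncoupled_partition \<Gamma>" "B \<in> maximal_uncoupled_partition \<Gamma>"
    and "a \<in> A" "b \<in> B" "fst a = fst b \<or> snd a = snd b"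
  shows "A = B"
proof -
  let ?r = "(coupling \<Gamma>)\<^sup>*"
  obtain a0 b0 where A: "a0 \<in> \<Gamma>" "A = ?r `` {a0}" and B: "b0 \<in> \<Gamma>" "B = ?r `` {b0}"
    using assms(1,2) by (auto simp: maximal_uncoupled_partition_def quotient_def)
  have "a \<in> \<Gamma>" "b \<in> \<Gamma>" using A B assms(3,4) coupling_class_subset by blast+
  then have "(a, b) \<in> ?r" using assms(5) by (auto simp: coupling_def)
  moreover have "(a0, a) \<in> ?r" "(b0, b) \<in> ?r" using A B assms(3,4) by auto
  ultimately have "(a0, b0) \<in> ?r"
    using equiv_coupling[of \<Gamma>] by (blast elim: equivE dest: symD intro: rtrancl_trans)
  from equiv_class_eq[OF equiv_coupling this] show ?thesis using A(2) B(2) by simp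
qed

lemma uncoupled_maximal: "uncoupled_partition \<Gamma> (maximal_uncoupled_partition \<Gamma>)"
  unfolding uncoupled_partition_def
proof (intro conjI)
  let ?P = "maximal_uncoupled_partition \<Gamma>"
  show "partition_on \<Gamma> ?P"
  proof (rule partition_onI)
    show "\<Union>?P = \<Gamma>"
      using coupling_class_subset
      by (fastforce simp: maximal_uncoupled_partition_def quotient_def)
    show "disjnt A B" if "A \<in> ?P" "B \<in> ?P" "A \<noteq> B" for A B
      using coupled_same_class[OF that(1,2)] that(3) by (auto simp: disjnt_iff)
    show "{} \<notin> ?P"
      by (auto simp: maximal_uncoupled_partition_def quotient_def)
  qed
  show "horizontally_uncoupled ?P"
    using coupled_same_class by (fastforce simp: horizontally_uncoupled_def)
  show "vertically_uncoupled ?P"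
    using coupled_same_class by (fastforce simp: vertically_uncoupled_def)
qed

lemma maximal_refines:
  assumes "uncoupled_partition \<Gamma> P"
  shows "refines \<Gamma> (maximal_uncoupled_partition \<Gamma>) P"
  unfolding refines_def
proof (intro conjI ballI)
  show "partition_on \<Gamma> (maximal_uncoupled_partition \<Gamma>)"
    using uncoupled_maximal by (simp add: uncoupled_partition_def)
  show part: "partition_on \<Gamma> P"
    using assms by (simp add: uncoupled_partition_def)
  fix X assume "X \<in> maximal_uncoupled_partition \<Gamma>"
  then obtain a where a: "a \<in> \<Gamma>" "X = (coupling \<Gamma>)\<^sup>* `` {a}"
    by (auto simp: maximal_uncoupled_partition_def quotient_def)
  obtain Y where Y: "Y \<in> P" "a \<in> Y"
    using part a(1) by (auto simp: partition_on_def)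
  have "b \<in> Y" if "(a, b) \<in> (coupling \<Gamma>)\<^sup>*" for b
    using that
  proof (induction rule: rtrancl_induct)
    case (step b c)
    then have "c \<in> \<Gamma>" and bc: "fst b = fst c \<or> snd b = snd c" by (auto simp: coupling_def)
    then obtain Z where Z: "Z \<in> P" "c \<in> Z" using part by (auto simp: partition_on_def)
    have "Y = Z"
    proof (rule ccontr)
      assume "Y \<noteq> Z"
      have "fst c \<noteq> fst b"
        using assms \<open>Y \<noteq> Z\<close> Y(1) Z step.IH
        unfolding uncoupled_partition_def horizontally_uncoupled_def
        by (cases b, cases c) fastforce
      moreover have "snd c \<noteq> snd b"
        using assms \<open>Y \<noteq> Z\<close> Y(1) Z step.IH
        unfolding uncoupled_partition_def vertically_uncoupled_def
        by (cases b, cases c) fastforce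
      ultimately show False using bc by auto
    qed
    then show ?case using Z by simp
  qed (use Y in simp)
  then have "X \<subseteq> Y" using a(2) by auto
  with Y(1) show "\<exists>Y\<in>P. X \<subseteq> Y" by blast
qed

lemma maximal_largest:
  assumes P: "uncoupled_partition \<Gamma> P" and fin: "finite (maximal_uncoupled_partition \<Gamma>)"
  shows "finite P \<and> card P \<le> card (maximal_uncoupled_partition \<Gamma>) \<and>
    (card P = card (maximal_uncoupled_partition \<Gamma>) \<longrightarrow> P = maximal_uncoupled_partition \<Gamma>)"
proof -
  let ?M = "maximal_uncoupled_partition \<Gamma>"
  have ref: "\<forall>X\<in>?M. \<exists>Y\<in>P. X \<subseteq> Y" and pM: "partition_on \<Gamma> ?M" and pP: "partition_on \<Gamma> P"
    using maximal_refines[OF P] by (auto simp: refines_def)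
  from ref obtain f where f: "\<And>X. X \<in> ?M \<Longrightarrow> f X \<in> P \<and> X \<subseteq> f X" by metis
  have hit: "\<exists>X\<in>?M. y \<in> X \<and> f X = Y" if Y: "Y \<in> P" "y \<in> Y" for Y y
  proof -
    obtain X where X: "X \<in> ?M" "y \<in> X"
      using pM pP Y by (auto simp: partition_on_def)
    have "f X = Y"
      using f[OF X(1)] X(2) Y pP
      by (meson disjnt_iff in_mono partition_on_def pairwise_def)
    then show ?thesis using X by blast
  qed
  have img: "f ` ?M = P"
  proof
    show "P \<subseteq> f ` ?M"
    proof
      fix Y assume "Y \<in> P"
      moreover from this obtain y where "y \<in> Y"
        using pP by (metis all_not_in_conv partition_on_def)
      ultimately show "Y \<in> f ` ?M" using hit by blast
    qed
  qed (use f in auto)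
  have "P = ?M" if "card P = card ?M"
  proof -
    have inj: "inj_on f ?M" using fin img that by (simp add: eq_card_imp_inj_on)
    have "f X = X" if X: "X \<in> ?M" for X
    proof
      show "f X \<subseteq> X"
      proof
        fix y assume "y \<in> f X"
        then obtain X' where "X' \<in> ?M" "y \<in> X'" "f X' = f X" using hit f X by blast
        then show "y \<in> X" using inj X by (auto dest: inj_onD)
      qed
    qed (use f X in auto)
    then show ?thesis using img by auto
  qed
  then show ?thesis using img fin card_image_le by (metis finite_imageI)
qed

definition pairwise_coupled :: "walk \<Rightarrow> (real \<times> real) set \<Rightarrow> bool" where
  "pairwise_coupled R \<Gamma>' \<longleftrightarrow>
     \<Gamma>' \<subseteq> curve_unit R \<and> (\<exists>A. maximal_uncoupled_partition \<Gamma>' = {A})"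


section \<open>Measures induced by a set of geometric terms\<close>

definition monomially_separated :: "(real \<times> real) set \<Rightarrow> bool" where
  "monomially_separated \<Gamma> \<longleftrightarrow>
     (\<forall>(\<rho>, \<sigma>)\<in>\<Gamma>. \<exists>w v :: nat. w > 0 \<and> v > 0 \<and>
        (\<forall>(\<rho>', \<sigma>')\<in>\<Gamma> - {(\<rho>, \<sigma>)}. \<rho>' ^ w * \<sigma>' ^ v \<noteq> \<rho> ^ w * \<sigma> ^ v))"

definition induced_measure ::
    "(real \<times> real) set \<Rightarrow> (real \<times> real \<Rightarrow> real) \<Rightarrow> (state \<Rightarrow> real) \<Rightarrow> bool" where
  "induced_measure \<Gamma> \<alpha> m \<longleftrightarrow>
     (\<forall>\<gamma>\<in>\<Gamma>. \<alpha> \<gamma> \<noteq> 0) \<and>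
     (\<lambda>(\<rho>, \<sigma>). \<bar>\<alpha> (\<rho>, \<sigma>)\<bar> * (1 / (1 - \<rho>)) * (1 / (1 - \<sigma>))) summable_on \<Gamma> \<and>
     (\<forall>i j. m (i, j) = (\<Sum>\<^sub>\<infinity>(\<rho>, \<sigma>)\<in>\<Gamma>. \<alpha> (\<rho>, \<sigma>) * \<rho> ^ i * \<sigma> ^ j))"

end

theory Submission
  imports Defs
begin

text \<open>
  A discrete signed measure on the unit interval all of whose moments vanish gives mass zero to
  every point. Applied to the interior balance equations along \<open>z = \<rho>\<^sup>w \<sigma>\<^sup>v\<close>, this
  puts every term of \<open>\<Gamma>\<close> on the curve; applied to the equations of the axes, it makes them hold
  separately for each group of terms with a common \<open>\<rho>\<close> (respectively \<open>\<sigma>\<close>). Hence every class of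
  the maximal uncoupled partition induces a finite signed measure that satisfies all balance
  equations. By irreducibility this measure is a multiple of \<open>m\<close>, and since the geometric terms
  are linearly independent the class is all of \<open>\<Gamma>\<close>: there is in fact exactly one class.
\<close>

section \<open>Finite signed invariant measures of a Markov kernel\<close>

lemma pmf_has_sum_1: "(pmf p has_sum 1) UNIV"
  using infsetsum_infsum[OF pmf_abs_summable, of p UNIV] infsetsum_pmf_eq_1[of p UNIV]
    abs_summable_equivalent[of "pmf p" UNIV] pmf_abs_summable[of p UNIV]
  by (simp add: has_sum_iff)

lemma summable_on_abs:
  fixes f :: "'a \<Rightarrow> real"
  shows "f summable_on A \<Longrightarrow> (\<lambda>x. \<bar>f x\<bar>) summable_on A"
  using summable_on_iff_abs_summable_on_real[of f A] by simp

text \<open>In absolute value the row of \<open>x\<close> sums to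
  \<open>\<bar>\<nu> x\<bar>\<close>, so the double family is absolutely summable. This licenses
  interchanging the sums over source and target.\<close>

lemma summable_on_kernel:
  fixes \<nu> :: "'a \<Rightarrow> real"
  assumes "\<nu> summable_on UNIV"
  shows "(\<lambda>(x, y). \<nu> x * pmf (K x) y) summable_on UNIV"
proof -
  have "(\<lambda>(x, y). \<bar>\<nu> x\<bar> * pmf (K x) y) summable_on UNIV \<times> UNIV"
  proof (rule summable_on_SigmaI)
    show "((\<lambda>y. case (x, y) of (x, y) \<Rightarrow> \<bar>\<nu> x\<bar> * pmf (K x) y) has_sum \<bar>\<nu> x\<bar>) UNIV" for x
      using has_sum_cmult_right[OF pmf_has_sum_1, of "\<bar>\<nu> x\<bar>" "K x"] by simp
    show "(\<lambda>x. \<bar>\<nu> x\<bar>) summable_on UNIV"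
      using assms by (rule summable_on_abs)
  qed auto
  then have "(\<lambda>z. norm ((\<lambda>(x, y). \<nu> x * pmf (K x) y) z)) summable_on UNIV"
    by (simp add: case_prod_unfold abs_mult)
  then show ?thesis by (rule abs_summable_summable)
qed

text \<open>Interchanging the sums leaves the row sums of the kernel, which are 1: a kernel
  preserves total mass, for signed measures too.\<close>

lemma has_sum_kernel_image:
  fixes \<nu> :: "'a \<Rightarrow> real"
  assumes "\<nu> summable_on UNIV"
  shows "((\<lambda>y. \<Sum>\<^sub>\<infinity>x. \<nu> x * pmf (K x) y) has_sum (\<Sum>\<^sub>\<infinity>x. \<nu> x)) UNIV"
proof -
  have s: "(\<lambda>(x, y). \<nu> x * pmf (K x) y) summable_on UNIV \<times> UNIV"
    using summable_on_kernel[OF assms] by simp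
  then have s': "(\<lambda>(y, x). \<nu> x * pmf (K x) y) summable_on UNIV \<times> UNIV"
    by (subst summable_on_swap) (simp add: case_prod_unfold)
  have "(\<Sum>\<^sub>\<infinity>y. \<Sum>\<^sub>\<infinity>x. \<nu> x * pmf (K x) y) = (\<Sum>\<^sub>\<infinity>x. \<Sum>\<^sub>\<infinity>y. \<nu> x * pmf (K x) y)"
    using infsum_swap_banach[OF s] by simp
  also have "\<dots> = (\<Sum>\<^sub>\<infinity>x. \<nu> x)"
    by (intro infsum_cong) (use infsumI[OF has_sum_cmult_right[OF pmf_has_sum_1]] in simp)
  finally show ?thesis
    using summable_on_Sigma_banach[OF s'] by (simp add: has_sum_iff)
qed

lemma summable_on_kernel_image_summand:
  fixes \<nu> :: "'a \<Rightarrow> real"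
  assumes "\<nu> summable_on UNIV"
  shows "(\<lambda>x. \<nu> x * pmf (K x) y) summable_on UNIV"
proof (rule abs_summable_summable, rule Infinite_Sum.abs_summable_on_comparison_test')
  show "(\<lambda>x. \<bar>\<nu> x\<bar>) summable_on UNIV"
    using assms by (rule summable_on_abs)
qed (simp add: abs_mult mult_left_le pmf_le_1)

text \<open>By conservation of mass the defects \<open>d y\<close> sum to 0, and only
  \<open>d z\<close> can be nonzero. This supplies the equation at the origin, which
  \<open>balance_equations\<close> omits.\<close>

lemma invariant_at_remaining_state:
  fixes \<nu> :: "'a \<Rightarrow> real"
  assumes sum: "\<nu> summable_on UNIV"
    and inv: "\<And>y. y \<noteq> z \<Longrightarrow> \<nu> y = (\<Sum>\<^sub>\<infinity>x. \<nu> x * pmf (K x) y)"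
  shows "\<nu> y = (\<Sum>\<^sub>\<infinity>x. \<nu> x * pmf (K x) y)"
proof -
  define d where "d y = \<nu> y - (\<Sum>\<^sub>\<infinity>x. \<nu> x * pmf (K x) y)" for y
  have "(d has_sum 0) UNIV"
    unfolding d_def
    using has_sum_add[OF has_sum_infsum[OF sum] has_sum_uminusI[OF has_sum_kernel_image[OF sum, of K]]]
    by simp
  moreover have "(d has_sum d z) UNIV"
    by (rule has_sum_finite_neutralI[where B = "{z}"]) (auto simp: d_def inv)
  ultimately have "d z = 0" using has_sum_unique by blast
  then show ?thesis using inv by (cases "y = z") (auto simp: d_def)
qed

text \<open>The absolute value of a finite signed invariant measure is again invariant, since
  \<^term>\<open>\<lambda>y. \<Sum>\<^sub>\<infinity>x. \<bar>\<nu> x\<bar> * pmf (K x) y\<close> dominates it and has the same total mass.\<close>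

lemma signed_invariant_eq_0:
  fixes \<nu> :: "'a \<Rightarrow> real"
  assumes irr: "irreducible_chain K"
    and sum: "\<nu> summable_on UNIV"
    and inv: "\<And>y. \<nu> y = (\<Sum>\<^sub>\<infinity>x. \<nu> x * pmf (K x) y)"
    and zero: "\<nu> z = 0"
  shows "\<nu> x = 0"
proof -
  define N where "N y = (\<Sum>\<^sub>\<infinity>x. \<bar>\<nu> x\<bar> * pmf (K x) y)" for y
  have asum: "(\<lambda>x. \<bar>\<nu> x\<bar>) summable_on UNIV"
    using sum by (rule summable_on_abs)
  have le: "\<bar>\<nu> y\<bar> \<le> N y" for y
    using norm_infsum_bound[of "\<lambda>x. \<nu> x * pmf (K x) y" UNIV]
      summable_on_kernel_image_summand[OF asum, of K y] inv[of y]
    by (simp add: N_def abs_mult)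
  have "((\<lambda>y. N y - \<bar>\<nu> y\<bar>) has_sum 0) UNIV"
    using has_sum_add[OF has_sum_kernel_image[OF asum, of K] has_sum_uminusI[OF has_sum_infsum[OF asum]]]
    by (simp add: N_def)
  then have "N y - \<bar>\<nu> y\<bar> = 0" for y
    using nonneg_has_sum_le_0D[of "\<lambda>y. N y - \<bar>\<nu> y\<bar>" UNIV 0 y] le by auto
  then have N: "N y = \<bar>\<nu> y\<bar>" for y by (metis diff_eq_eq add_0)
  \<comment> \<open>At a zero \<open>y\<close> the nonnegative terms of \<open>N y\<close> sum to 0,
    so \<nu> vanishes at every one-step predecessor of \<open>y\<close>.\<close>
  have step: "\<nu> x = 0" if "\<nu> y = 0" "y \<in> set_pmf (K x)" for x y
  proof -
    have "\<bar>\<nu> x\<bar> * pmf (K x) y = 0"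
      using nonneg_infsum_le_0D[of "\<lambda>x. \<bar>\<nu> x\<bar> * pmf (K x) y" UNIV x]
        summable_on_kernel_image_summand[OF asum, of K y] N[of y] that(1)
      by (simp add: N_def)
    then show ?thesis using that(2) by (simp add: set_pmf_iff)
  qed
  \<comment> \<open>Zeros spread backwards along paths; irreducibility provides a path from any
    \<open>x\<close> to \<open>z\<close>.\<close>
  have path: "\<nu> x = 0" if "\<nu> y = 0" "y \<in> set_pmf (n_step K n x)" for n x y
    using that(2)
  proof (induction n arbitrary: x)
    case 0
    then show ?case using that(1) by simp
  next
    case (Suc n)
    then obtain u where "u \<in> set_pmf (K x)" "y \<in> set_pmf (n_step K n u)" by auto
    then show ?case using Suc.IH step by blast
  qed
  obtain n where "pmf (n_step K n x) z > 0"
    using irr by (auto simp: irreducible_chain_def)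
  then show ?thesis using path[OF zero] by (simp add: pmf_positive_iff)
qed


section \<open>Moments of a discrete measure on the unit interval\<close>

lemma summable_on_times_bounded:
  fixes b :: "'a \<Rightarrow> real"
  assumes "b summable_on A" "\<And>a. a \<in> A \<Longrightarrow> \<bar>g a\<bar> \<le> C"
  shows "(\<lambda>a. b a * g a) summable_on A"
proof (rule abs_summable_summable, rule Infinite_Sum.abs_summable_on_comparison_test')
  show "(\<lambda>a. \<bar>b a\<bar> * C) summable_on A"
    using summable_on_abs[OF assms(1)] by (rule summable_on_cmult_left)
qed (simp add: abs_mult assms(2) mult_left_mono)

text \<open>Polynomials in \<^term>\<open>z\<close> integrate to zero; the powers of \<^term>\<open>1 - (z - t)\<^sup>2\<close> decrease to
  the indicator of the fibre over \<^term>\<open>t\<close>.\<close>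

lemma fibre_sum_eq_0:
  fixes b :: "'a \<Rightarrow> real" and z :: "'a \<Rightarrow> real"
  assumes sum: "b summable_on A"
    and z: "\<And>a. a \<in> A \<Longrightarrow> 0 \<le> z a \<and> z a \<le> 1"
    and mom: "\<And>k. (\<Sum>\<^sub>\<infinity>a\<in>A. b a * z a ^ k) = 0"
    and t: "0 \<le> t" "t \<le> 1"
  shows "(\<Sum>\<^sub>\<infinity>a\<in>{a \<in> A. z a = t}. b a) = 0"
proof -
  define q where "q a = 1 - (z a - t)\<^sup>2" for a
  have q: "0 \<le> q a" "q a \<le> 1" if "a \<in> A" for a
  proof -
    have "\<bar>z a - t\<bar> \<le> 1" using z[OF that] t by auto
    then have "(z a - t)\<^sup>2 \<le> 1" using abs_square_le_1 by blast
    then show "0 \<le> q a" "q a \<le> 1" by (auto simp: q_def)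
  qed
  have bd: "\<bar>q a ^ n * z a ^ k\<bar> \<le> 1" if "a \<in> A" for a n k
    using q[OF that] z[OF that] by (auto simp: abs_mult intro!: mult_le_one power_le_one)
  have s: "(\<lambda>a. b a * (q a ^ n * z a ^ k)) summable_on A" for n k
    by (rule summable_on_times_bounded[OF sum]) (rule bd)
  \<comment> \<open>The expansion \<open>q = (1 - t\<^sup>2) + 2 * t * z - z\<^sup>2\<close> trades
    one factor \<open>q\<close> for higher powers of \<open>z\<close>, so the induction has to run
    over all \<open>k\<close> at once.\<close>
  have qmom: "(\<Sum>\<^sub>\<infinity>a\<in>A. b a * (q a ^ n * z a ^ k)) = 0" for n k
  proof (induction n arbitrary: k)
    case 0
    then show ?case by (simp add: mom)
  next
    case (Suc n)
    have h: "((\<lambda>a. b a * (q a ^ n * z a ^ k)) has_sum 0) A" for k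
      using Suc s by (metis has_sum_infsum)
    have "((\<lambda>a. (1 - t\<^sup>2) * (b a * (q a ^ n * z a ^ k)) + (2 * t * (b a * (q a ^ n * z a ^ Suc k))
        + (- 1) * (b a * (q a ^ n * z a ^ (k + 2))))) has_sum ((1 - t\<^sup>2) * 0 + (2 * t * 0 + (- 1) * 0))) A"
      by (intro has_sum_add has_sum_cmult_right h)
    moreover have "(1 - t\<^sup>2) * (b a * (q a ^ n * z a ^ k)) + (2 * t * (b a * (q a ^ n * z a ^ Suc k))
        + (- 1) * (b a * (q a ^ n * z a ^ (k + 2)))) = b a * (q a ^ Suc n * z a ^ k)" for a
      unfolding q_def by (simp add: algebra_simps power2_eq_square)
    ultimately show ?case by (auto intro: infsumI)
  qed
  define F where "F n a = b a * q a ^ n" for n a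
  \<comment> \<open>\<open>infsetsum\<close> is an integral over counting measure, so dominated
    convergence applies with majorant \<open>norm (b a)\<close>.\<close>
  have Fs: "Infinite_Set_Sum.abs_summable_on (F n) A" for n
    using summable_on_abs[OF summable_on_times_bounded[OF sum, where g = "\<lambda>a. q a ^ n" and C = 1]]
      bd[of _ n 0] abs_summable_equivalent[of "F n" A] by (simp add: F_def[abs_def])
  have F0: "infsetsum (F n) A = 0" for n
    using infsetsum_infsum[OF Fs[of n]] qmom[of n 0] by (simp add: F_def[abs_def])
  have "(\<lambda>n. infsetsum (F n) A) \<longlonglongrightarrow> infsetsum (\<lambda>a. if z a = t then b a else 0) A"
    unfolding infsetsum_def
  proof (rule integral_dominated_convergence[where w = "\<lambda>a. norm (b a)"])
    show "integrable (count_space A) (\<lambda>a. norm (b a))"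
      using summable_on_abs[OF sum] abs_summable_equivalent[of b A]
      by (simp add: abs_summable_on_def)
    show "AE a in count_space A. (\<lambda>n. F n a) \<longlonglongrightarrow> (if z a = t then b a else 0)"
    proof (rule AE_I2)
      fix a assume "a \<in> space (count_space A)"
      then have a: "a \<in> A" by simp
      show "(\<lambda>n. F n a) \<longlonglongrightarrow> (if z a = t then b a else 0)"
      proof (cases "z a = t")
        case True
        then show ?thesis by (simp add: F_def q_def)
      next
        case False
        then have "\<bar>q a\<bar> < 1" using q[OF a] by (simp add: q_def)
        then have "(\<lambda>n. b a * q a ^ n) \<longlonglongrightarrow> b a * 0"
          by (intro tendsto_mult tendsto_const LIMSEQ_abs_realpow_zero2) 
        then show ?thesis using False by (simp add: F_def)
      qed
    qed
    show "AE a in count_space A. norm (F n a) \<le> norm (b a)" for n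
      using bd[of _ n 0] by (auto intro!: AE_I2 mult_left_le simp: F_def abs_mult)
  qed auto
  then have "infsetsum (\<lambda>a. if z a = t then b a else 0) A = 0"
    using F0 by (simp add: LIMSEQ_const_iff)
  moreover have "(\<lambda>a. norm (if z a = t then b a else 0)) summable_on A"
    by (rule Infinite_Sum.abs_summable_on_comparison_test'[OF summable_on_abs[OF sum]]) auto
  ultimately have "(\<Sum>\<^sub>\<infinity>a\<in>A. if z a = t then b a else 0) = 0"
    using infsetsum_infsum abs_summable_equivalent by metis
  moreover have "(\<Sum>\<^sub>\<infinity>a\<in>{a \<in> A. z a = t}. b a) = (\<Sum>\<^sub>\<infinity>a\<in>A. if z a = t then b a else 0)"
    by (rule infsum_cong_neutral) auto
  ultimately show ?thesis by simp
qed

text \<open>\<open>A\<close> is the disjoint union of the fibres of \<open>h\<close>, indexed by the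
  Sigma set \<open>?S\<close>; absolute summability allows summing fibre by fibre.\<close>

lemma infsum_eq_0_if_fibre_sums_eq_0:
  fixes b :: "'a \<Rightarrow> real"
  assumes sum: "b summable_on A"
    and fib: "\<And>a. a \<in> A \<Longrightarrow> (\<Sum>\<^sub>\<infinity>x\<in>{x \<in> A. h x = h a}. b x) = 0"
  shows "(\<Sum>\<^sub>\<infinity>a\<in>A. b a) = 0"
proof -
  let ?S = "Sigma (h ` A) (\<lambda>u. {x \<in> A. h x = u})"
  have bij: "bij_betw snd ?S A"
    by (rule bij_betwI[where g = "\<lambda>a. (h a, a)"]) auto
  have s: "(\<lambda>p. b (snd p)) summable_on ?S"
    using summable_on_reindex_bij_betw[OF bij, of b] sum by simp
  have "(\<Sum>\<^sub>\<infinity>a\<in>A. b a) = (\<Sum>\<^sub>\<infinity>p\<in>?S. b (snd p))"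
    using infsum_reindex_bij_betw[OF bij, of b] by simp
  also have "\<dots> = (\<Sum>\<^sub>\<infinity>u\<in>h ` A. \<Sum>\<^sub>\<infinity>x\<in>{x \<in> A. h x = u}. b x)"
    using infsum_Sigma_banach[OF s] by simp
  also have "\<dots> = 0"
  proof (rule infsum_0)
    show "(\<Sum>\<^sub>\<infinity>x\<in>{x \<in> A. h x = u}. b x) = 0" if "u \<in> h ` A" for u
      using fib that by blast
  qed
  finally show ?thesis .
qed

text \<open>With \<open>z = \<rho>^w * \<sigma>^v\<close> the powers \<open>z^k\<close> are
  monomials, so all moments of \<open>z\<close> vanish. The exponents are chosen for the given
  \<gamma>, which makes its fibre under \<open>z\<close> a singleton.\<close>

lemma monomially_separated_independent:
  fixes b :: "real \<times> real \<Rightarrow> real"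
  assumes sep: "monomially_separated \<Gamma>"
    and sub: "\<Gamma> \<subseteq> unit_square"
    and sum: "b summable_on \<Gamma>"
    and mom: "\<And>i j. (\<Sum>\<^sub>\<infinity>\<gamma>\<in>\<Gamma>. b \<gamma> * (fst \<gamma> ^ i * snd \<gamma> ^ j)) = 0"
    and \<gamma>: "\<gamma> \<in> \<Gamma>"
  shows "b \<gamma> = 0"
proof -
  obtain w v where wv: "\<And>\<gamma>'. \<gamma>' \<in> \<Gamma> \<Longrightarrow> \<gamma>' \<noteq> \<gamma> \<Longrightarrow>
      fst \<gamma>' ^ w * snd \<gamma>' ^ v \<noteq> fst \<gamma> ^ w * snd \<gamma> ^ v"
    using sep \<gamma> unfolding monomially_separated_def by (cases \<gamma>) fastforce
  define z where "z \<gamma>' = fst \<gamma>' ^ w * snd \<gamma>' ^ v" for \<gamma>' :: "real \<times> real"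
  have z: "0 \<le> z \<gamma>' \<and> z \<gamma>' \<le> 1" if "\<gamma>' \<in> \<Gamma>" for \<gamma>'
    using that sub
    by (auto simp: z_def unit_square_def intro!: mult_le_one power_le_one)
  have "(\<Sum>\<^sub>\<infinity>\<gamma>'\<in>{\<gamma>' \<in> \<Gamma>. z \<gamma>' = z \<gamma>}. b \<gamma>') = 0"
  proof (rule fibre_sum_eq_0[OF sum z])
    show "(\<Sum>\<^sub>\<infinity>\<gamma>'\<in>\<Gamma>. b \<gamma>' * z \<gamma>' ^ k) = 0" for k
      using mom[of "w * k" "v * k"] by (simp add: z_def power_mult power_mult_distrib)
  qed (use z[OF \<gamma>] in auto)
  moreover have "{\<gamma>' \<in> \<Gamma>. z \<gamma>' = z \<gamma>} = {\<gamma>}"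
    using wv \<gamma> by (auto simp: z_def)
  ultimately show ?thesis by simp
qed


section \<open>Balance equations of a homogeneous walk\<close>

lemma atLeastAtMost_minus_1_1: "{-1..1} = {-1, 0, 1 :: int}"
  by auto

lemma pmf_eq_step_prob:
  "pmf (R (a, b)) (i, j) = step_prob R (int i - int a) (int j - int b) (int a) (int b)"
  by (simp add: step_prob_def)

text \<open>Only displacements in \<open>{-1..1}\<close> contribute. Those with a source outside the
  quarter-plane may stay in the sum: \<open>nat\<close> then truncates the argument of \<nu> to a
  meaningless state, but the factor \<open>step_prob\<close> is 0.\<close>

lemma has_sum_into_state:
  assumes hom: "homogeneous_walk R"
  shows "((\<lambda>x. \<nu> x * pmf (R x) (i, j)) has_sum
    (\<Sum>s\<in>{-1..1}. \<Sum>t\<in>{-1..1}. \<nu> (nat (int i - s), nat (int j - t)) *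
       step_prob R s t (int i - s) (int j - t))) UNIV"
proof -
  \<comment> \<open>The displacements whose source lies in the quarter-plane. On them
    \<open>nat\<close> does not truncate, so \<open>?g\<close> is injective.\<close>
  let ?P = "{(s, t) \<in> {-1..1} \<times> {-1..1}. s \<le> int i \<and> t \<le> int j}"
  let ?g = "\<lambda>(s, t). (nat (int i - s), nat (int j - t))"
  let ?f = "\<lambda>(s, t). \<nu> (nat (int i - s), nat (int j - t)) * step_prob R s t (int i - s) (int j - t)"
  have inj: "inj_on ?g ?P" by (auto simp: inj_on_def)
  have fin: "finite ?P" by (rule finite_subset[of _ "{-1..1} \<times> {-1..1}"]) auto
  have far: "\<forall>s t a b. \<bar>s\<bar> > 1 \<or> \<bar>t\<bar> > 1 \<longrightarrow> step_prob R s t a b = 0"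
    using hom unfolding homogeneous_walk_def by (rule conjunct1)
  show ?thesis
  proof (rule has_sum_finite_neutralI)
    show "finite (?g ` ?P)" using fin by simp
    show "\<nu> x * pmf (R x) (i, j) = 0" if x: "x \<in> UNIV - ?g ` ?P" for x
    proof -
      obtain a b where ab: "x = (a, b)" by (cases x)
      have "(int i - int a, int j - int b) \<notin> ?P"
      proof
        assume "(int i - int a, int j - int b) \<in> ?P"
        from imageI[OF this, of ?g] x ab show False by simp
      qed
      then have "\<bar>int i - int a\<bar> > 1 \<or> \<bar>int j - int b\<bar> > 1" by auto
      then have "pmf (R x) (i, j) = 0"
        unfolding ab pmf_eq_step_prob using far by blast
      then show ?thesis by simp
    qed
    have "(\<Sum>x\<in>?g ` ?P. \<nu> x * pmf (R x) (i, j)) = (\<Sum>p\<in>?P. ?f p)"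
      unfolding sum.reindex[OF inj]
      by (rule sum.cong) (auto simp: pmf_eq_step_prob)
    also have "\<dots> = (\<Sum>p\<in>{-1..1} \<times> {-1..1}. ?f p)"
      by (rule sum.mono_neutral_left) (auto simp: step_prob_def split: if_splits)
    finally show "(\<Sum>s\<in>{-1..1}. \<Sum>t\<in>{-1..1}. \<nu> (nat (int i - s), nat (int j - t)) *
        step_prob R s t (int i - s) (int j - t)) = (\<Sum>x\<in>?g ` ?P. \<nu> x * pmf (R x) (i, j))"
      unfolding sum.cartesian_product by (rule sym)
  qed auto
qed

section \<open>Incoming probabilities of a homogeneous walk\<close>

lemma mem_interior_states: "(i, j) \<in> interior_states \<longleftrightarrow> i > 0 \<and> j > 0"
  by (simp add: interior_states_def)

lemma mem_horizontal_axis: "(i, j) \<in> horizontal_axis \<longleftrightarrow> i > 0 \<and> j = 0"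
  by (simp add: horizontal_axis_def)

lemma mem_vertical_axis: "(i, j) \<in> vertical_axis \<longleftrightarrow> i = 0 \<and> j > 0"
  by (simp add: vertical_axis_def)

lemma homogeneous_walkD:
  assumes "homogeneous_walk R" "A \<in> {interior_states, horizontal_axis, vertical_axis}"
    "(i, j) \<in> A" "(k, l) \<in> A" "s \<in> {-1..1}" "t \<in> {-1..1}"
  shows "step_prob R s t i j = step_prob R s t k l"
    and "step_prob R s t (i - s) (j - t) = step_prob R s t (k - s) (l - t)"
proof -
  have "\<forall>(i, j)\<in>A. \<forall>(k, l)\<in>A. \<forall>s\<in>{-1..1}. \<forall>t\<in>{-1..1}.
      step_prob R s t i j = step_prob R s t k l \<and>
      step_prob R s t (i - s) (j - t) = step_prob R s t (k - s) (l - t)"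
    by (rule bspec[OF conjunct2[OF assms(1)[unfolded homogeneous_walk_def]] assms(2)])
  from bspec[OF this assms(3), unfolded prod.case, THEN bspec, OF assms(4), unfolded prod.case,
      THEN bspec, OF assms(5), THEN bspec, OF assms(6)]
  show "step_prob R s t i j = step_prob R s t k l"
    and "step_prob R s t (i - s) (j - t) = step_prob R s t (k - s) (l - t)"
    by simp_all
qed

text \<open>The source may lie on an axis. Homogeneity of incoming transitions moves the target to
  \<open>(2 + s, 2 + t)\<close>, whose source \<open>(2, 2)\<close> is interior; homogeneity of
  outgoing transitions then moves the source to \<open>(1, 1)\<close>.\<close>

lemma step_prob_into_interior:
  assumes hom: "homogeneous_walk R" and "i > 0" "j > 0" "s \<in> {-1..1}" "t \<in> {-1..1}"
  shows "step_prob R s t (i - s) (j - t) = p_int R s t"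
proof -
  \<comment> \<open>The differences are left unevaluated to match the form \<open>k - s\<close>,
    \<open>l - t\<close> of the homogeneity rule.\<close>
  have "step_prob R s t (i - s) (j - t) = step_prob R s t (2 + s - s) (2 + t - t)"
    by (rule homogeneous_walkD(2)[OF hom, of interior_states])
      (use assms in \<open>simp_all add: mem_interior_states\<close>)
  also have "\<dots> = step_prob R s t 1 1"
    by (rule homogeneous_walkD(1)[OF hom, of interior_states])
      (use assms in \<open>simp_all add: mem_interior_states\<close>)
  finally show ?thesis by (simp add: p_int_def)
qed

text \<open>As for the interior, with target \<open>(2 + s, 0)\<close>: the source is then the
  interior state \<open>(2, 1)\<close> or the axis state \<open>(2, 0)\<close>.\<close>

lemma step_prob_into_horizontal_axis:
  assumes hom: "homogeneous_walk R" and "i > 0" "s \<in> {-1..1}"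
  shows "step_prob R s (-1) (i - s) 1 = p_int R s (-1)"
    and "step_prob R s 0 (i - s) 0 = p_hor R s"
proof -
  have "step_prob R s (-1) (i - s) (0 - (-1)) = step_prob R s (-1) (2 + s - s) (0 - (-1))"
    by (rule homogeneous_walkD(2)[OF hom, of horizontal_axis])
      (use assms in \<open>simp_all add: mem_horizontal_axis\<close>)
  also have "\<dots> = step_prob R s (-1) 1 1"
    by (rule homogeneous_walkD(1)[OF hom, of interior_states])
      (use assms in \<open>simp_all add: mem_interior_states\<close>)
  finally show "step_prob R s (-1) (i - s) 1 = p_int R s (-1)" by (simp add: p_int_def)
  have "step_prob R s 0 (i - s) (0 - 0) = step_prob R s 0 (2 + s - s) (0 - 0)"
    by (rule homogeneous_walkD(2)[OF hom, of horizontal_axis])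
      (use assms in \<open>simp_all add: mem_horizontal_axis\<close>)
  also have "\<dots> = step_prob R s 0 1 0"
    by (rule homogeneous_walkD(1)[OF hom, of horizontal_axis])
      (use assms in \<open>simp_all add: mem_horizontal_axis\<close>)
  finally show "step_prob R s 0 (i - s) 0 = p_hor R s" by (simp add: p_hor_def)
qed

lemma step_prob_into_vertical_axis:
  assumes hom: "homogeneous_walk R" and "j > 0" "t \<in> {-1..1}"
  shows "step_prob R (-1) t 1 (j - t) = p_int R (-1) t"
    and "step_prob R 0 t 0 (j - t) = p_ver R t"
proof -
  have "step_prob R (-1) t (0 - (-1)) (j - t) = step_prob R (-1) t (0 - (-1)) (2 + t - t)"
    by (rule homogeneous_walkD(2)[OF hom, of vertical_axis])
      (use assms in \<open>simp_all add: mem_vertical_axis\<close>)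
  also have "\<dots> = step_prob R (-1) t 1 1"
    by (rule homogeneous_walkD(1)[OF hom, of interior_states])
      (use assms in \<open>simp_all add: mem_interior_states\<close>)
  finally show "step_prob R (-1) t 1 (j - t) = p_int R (-1) t" by (simp add: p_int_def)
  have "step_prob R 0 t (0 - 0) (j - t) = step_prob R 0 t (0 - 0) (2 + t - t)"
    by (rule homogeneous_walkD(2)[OF hom, of vertical_axis])
      (use assms in \<open>simp_all add: mem_vertical_axis\<close>)
  also have "\<dots> = step_prob R 0 t 0 1"
    by (rule homogeneous_walkD(1)[OF hom, of vertical_axis])
      (use assms in \<open>simp_all add: mem_vertical_axis\<close>)
  finally show "step_prob R 0 t 0 (j - t) = p_ver R t" by (simp add: p_ver_def)
qed

text \<open>Away from the origin the balance equations are the sums over incoming transitions,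
  rewritten by homogeneity; the origin follows from conservation of mass.\<close>

lemma invariant_if_balance_equations:
  assumes hom: "homogeneous_walk R" and bal: "balance_equations R \<nu>"
    and sum: "\<nu> summable_on UNIV"
  shows "\<nu> y = (\<Sum>\<^sub>\<infinity>x. \<nu> x * pmf (R x) y)"
proof (rule invariant_at_remaining_state[where z = "(0, 0)", OF sum])
  fix y :: state assume y: "y \<noteq> (0, 0)"
  obtain a b where "y = (a, b)" by (cases y)
  with y consider i j where "y = (i, j)" "i > 0" "j > 0" | i where "y = (i, 0)" "i > 0"
    | j where "y = (0, j)" "j > 0"
    by (cases a; cases b) simp_all
  then show "\<nu> y = (\<Sum>\<^sub>\<infinity>x. \<nu> x * pmf (R x) y)"
  proof cases
    case 1
    have "\<nu> (i, j) = (\<Sum>s\<in>{-1..1}. \<Sum>t\<in>{-1..1}. \<nu> (nat (int i - s), nat (int j - t)) * p_int R s t)"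
      by (rule bal[unfolded balance_equations_def, THEN conjunct1, rule_format, OF 1(2,3)])
    also have "\<dots> = (\<Sum>s\<in>{-1..1}. \<Sum>t\<in>{-1..1}. \<nu> (nat (int i - s), nat (int j - t)) *
        step_prob R s t (int i - s) (int j - t))"
      by (intro sum.cong refl) (use 1 step_prob_into_interior[OF hom] in simp)
    finally show ?thesis unfolding infsumI[OF has_sum_into_state[OF hom]] 1(1) .
  next
    case 2
    have "\<nu> (i, 0) = (\<Sum>s\<in>{-1..1}. \<nu> (nat (int i - s), 1) * p_int R s (-1)) +
        (\<Sum>s\<in>{-1..1}. \<nu> (nat (int i - s), 0) * p_hor R s)"
      by (rule bal[unfolded balance_equations_def, THEN conjunct2, THEN conjunct1, rule_format, OF 2(2)])
    also have "\<dots> = (\<Sum>s\<in>{-1..1}. \<nu> (nat (int i - s), 1) * step_prob R s (-1) (int i - s) 1 +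
        \<nu> (nat (int i - s), 0) * step_prob R s 0 (int i - s) 0)"
      unfolding sum.distrib[symmetric]
      by (intro sum.cong refl) (use 2 step_prob_into_horizontal_axis[OF hom] in simp)
    also have "\<dots> = (\<Sum>s\<in>{-1..1}. \<Sum>t\<in>{-1..1}. \<nu> (nat (int i - s), nat (int 0 - t)) *
        step_prob R s t (int i - s) (int 0 - t))"
    proof (intro sum.cong refl)
      fix s :: int
      \<comment> \<open>An upward step into row 0 would start in row -1, so only
        \<open>t = -1\<close> and \<open>t = 0\<close> survive.\<close>
      have "step_prob R s 1 (int i - s) (-1) = 0" by (simp add: step_prob_def)
      then show "\<nu> (nat (int i - s), 1) * step_prob R s (-1) (int i - s) 1 +
          \<nu> (nat (int i - s), 0) * step_prob R s 0 (int i - s) 0 =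
          (\<Sum>t\<in>{-1..1}. \<nu> (nat (int i - s), nat (int 0 - t)) * step_prob R s t (int i - s) (int 0 - t))"
        by (simp add: atLeastAtMost_minus_1_1)
    qed
    finally show ?thesis unfolding infsumI[OF has_sum_into_state[OF hom]] 2(1) .
  next
    case 3
    have "\<nu> (0, j) = (\<Sum>t\<in>{-1..1}. \<nu> (1, nat (int j - t)) * p_int R (-1) t) +
        (\<Sum>t\<in>{-1..1}. \<nu> (0, nat (int j - t)) * p_ver R t)"
      by (rule bal[unfolded balance_equations_def, THEN conjunct2, THEN conjunct2, rule_format, OF 3(2)])
    also have "\<dots> = (\<Sum>t\<in>{-1..1}. \<nu> (1, nat (int j - t)) * step_prob R (-1) t 1 (int j - t) +
        \<nu> (0, nat (int j - t)) * step_prob R 0 t 0 (int j - t))"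
      unfolding sum.distrib[symmetric]
      by (intro sum.cong refl) (use 3 step_prob_into_vertical_axis[OF hom] in simp)
    also have "\<dots> = (\<Sum>t\<in>{-1..1}. \<Sum>s\<in>{-1..1}. \<nu> (nat (int 0 - s), nat (int j - t)) *
        step_prob R s t (int 0 - s) (int j - t))"
    proof (intro sum.cong refl)
      fix t :: int
      have "step_prob R 1 t (-1) (int j - t) = 0" by (simp add: step_prob_def)
      then show "\<nu> (1, nat (int j - t)) * step_prob R (-1) t 1 (int j - t) +
          \<nu> (0, nat (int j - t)) * step_prob R 0 t 0 (int j - t) =
          (\<Sum>s\<in>{-1..1}. \<nu> (nat (int 0 - s), nat (int j - t)) * step_prob R s t (int 0 - s) (int j - t))"
        by (simp add: atLeastAtMost_minus_1_1)
    qed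
    also have "\<dots> = (\<Sum>s\<in>{-1..1}. \<Sum>t\<in>{-1..1}. \<nu> (nat (int 0 - s), nat (int j - t)) *
        step_prob R s t (int 0 - s) (int j - t))"
      by (rule sum.swap)
    finally show ?thesis unfolding infsumI[OF has_sum_into_state[OF hom]] 3(1) .
  qed
qed


section \<open>Sums of geometric terms\<close>

definition geometric_sum :: "(real \<times> real \<Rightarrow> real) \<Rightarrow> (real \<times> real) set \<Rightarrow> state \<Rightarrow> real" where
  "geometric_sum \<alpha> A = (\<lambda>(i, j). \<Sum>\<^sub>\<infinity>\<gamma>\<in>A. \<alpha> \<gamma> * (fst \<gamma> ^ i * snd \<gamma> ^ j))"

text \<open>Left minus right side of the interior equation at \<open>(i, j)\<close> for one term,
  divided by \<open>\<rho>^(i-1) * \<sigma>^(j-1)\<close>; this normalization keeps the exponents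
  \<open>1 - s\<close>, \<open>1 - t\<close> nonnegative. The axis defects are divided by
  \<open>\<rho>^(i-1)\<close> and \<open>\<sigma>^(j-1)\<close> respectively.\<close>

definition interior_defect :: "walk \<Rightarrow> real \<times> real \<Rightarrow> real" where
  "interior_defect R \<gamma> = fst \<gamma> * snd \<gamma> -
     (\<Sum>s\<in>{-1..1}. \<Sum>t\<in>{-1..1}. fst \<gamma> ^ nat (1 - s) * snd \<gamma> ^ nat (1 - t) * p_int R s t)"

definition horizontal_defect :: "walk \<Rightarrow> real \<times> real \<Rightarrow> real" where
  "horizontal_defect R \<gamma> = fst \<gamma> -
     ((\<Sum>s\<in>{-1..1}. fst \<gamma> ^ nat (1 - s) * snd \<gamma> * p_int R s (-1)) +
      (\<Sum>s\<in>{-1..1}. fst \<gamma> ^ nat (1 - s) * p_hor R s))"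

definition vertical_defect :: "walk \<Rightarrow> real \<times> real \<Rightarrow> real" where
  "vertical_defect R \<gamma> = snd \<gamma> -
     ((\<Sum>t\<in>{-1..1}. fst \<gamma> * snd \<gamma> ^ nat (1 - t) * p_int R (-1) t) +
      (\<Sum>t\<in>{-1..1}. snd \<gamma> ^ nat (1 - t) * p_ver R t))"

lemma interior_defect_eq: "interior_defect R \<gamma> = - eval2 (kernel_poly R) (fst \<gamma>) (snd \<gamma>)"
  by (simp add: interior_defect_def eval2_def kernel_poly_def poly_monom poly_sum poly_power mult_ac)

lemma has_sum_diff:
  fixes f g :: "'a \<Rightarrow> real"
  assumes "(f has_sum a) A" "(g has_sum b) A"
  shows "((\<lambda>x. f x - g x) has_sum a - b) A"
  using has_sum_add[OF assms(1) has_sum_uminusI[OF assms(2)]] by simp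

lemma has_sum_finite_sum:
  fixes g :: "'i \<Rightarrow> real"
  assumes "finite I" "\<And>i. i \<in> I \<Longrightarrow> (f i has_sum g i) A"
  shows "((\<lambda>x. \<Sum>i\<in>I. f i x) has_sum (\<Sum>i\<in>I. g i)) A"
  using assms
proof (induction rule: finite_induct)
  case empty
  then show ?case by simp
next
  case (insert k I)
  then show ?case by (simp add: has_sum_add)
qed

section \<open>Balance equations as vanishing moments of the defects\<close>

lemma has_sum_geometric_sum:
  assumes "A \<subseteq> unit_square" "\<alpha> summable_on A"
  shows "((\<lambda>\<gamma>. \<alpha> \<gamma> * (fst \<gamma> ^ i * snd \<gamma> ^ j)) has_sum geometric_sum \<alpha> A (i, j)) A"
proof -
  have "(\<lambda>\<gamma>. \<alpha> \<gamma> * (fst \<gamma> ^ i * snd \<gamma> ^ j)) summable_on A"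
    by (rule summable_on_times_bounded[OF assms(2), where C = 1])
      (use assms(1) in \<open>auto simp: unit_square_def abs_mult power_abs intro!: mult_le_one power_le_one\<close>)
  then show ?thesis by (simp add: geometric_sum_def)
qed

lemma nat_Suc_minus: "s \<in> {-1..1} \<Longrightarrow> nat (int (Suc i) - s) = i + nat (1 - s)"
  by auto

lemma has_sum_interior_defect:
  assumes "A \<subseteq> unit_square" "\<alpha> summable_on A"
  shows "((\<lambda>\<gamma>. \<alpha> \<gamma> * interior_defect R \<gamma> * (fst \<gamma> ^ i * snd \<gamma> ^ j)) has_sum
    geometric_sum \<alpha> A (Suc i, Suc j) - (\<Sum>s\<in>{-1..1}. \<Sum>t\<in>{-1..1}.
      geometric_sum \<alpha> A (nat (int (Suc i) - s), nat (int (Suc j) - t)) * p_int R s t)) A"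
proof -
  have eq: "\<alpha> \<gamma> * interior_defect R \<gamma> * (fst \<gamma> ^ i * snd \<gamma> ^ j) =
      \<alpha> \<gamma> * (fst \<gamma> ^ Suc i * snd \<gamma> ^ Suc j) - (\<Sum>s\<in>{-1..1}. \<Sum>t\<in>{-1..1}.
        \<alpha> \<gamma> * (fst \<gamma> ^ nat (int (Suc i) - s) * snd \<gamma> ^ nat (int (Suc j) - t)) * p_int R s t)" for \<gamma>
    unfolding interior_defect_def right_diff_distrib left_diff_distrib sum_distrib_left sum_distrib_right
    by (intro arg_cong2[of _ _ _ _ "(-)"] sum.cong)
      (simp_all add: nat_Suc_minus power_add mult_ac del: of_nat_Suc)
  show ?thesis
    unfolding eq
    by (intro has_sum_diff has_sum_finite_sum has_sum_cmult_left has_sum_geometric_sum assms) auto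
qed

lemma has_sum_horizontal_defect:
  assumes "A \<subseteq> unit_square" "\<alpha> summable_on A"
  shows "((\<lambda>\<gamma>. \<alpha> \<gamma> * horizontal_defect R \<gamma> * fst \<gamma> ^ i) has_sum
    geometric_sum \<alpha> A (Suc i, 0) -
      ((\<Sum>s\<in>{-1..1}. geometric_sum \<alpha> A (nat (int (Suc i) - s), 1) * p_int R s (-1)) +
       (\<Sum>s\<in>{-1..1}. geometric_sum \<alpha> A (nat (int (Suc i) - s), 0) * p_hor R s))) A"
proof -
  have eq: "\<alpha> \<gamma> * horizontal_defect R \<gamma> * fst \<gamma> ^ i =
      \<alpha> \<gamma> * (fst \<gamma> ^ Suc i * snd \<gamma> ^ 0) -
      ((\<Sum>s\<in>{-1..1}. \<alpha> \<gamma> * (fst \<gamma> ^ nat (int (Suc i) - s) * snd \<gamma> ^ 1) * p_int R s (-1)) +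
       (\<Sum>s\<in>{-1..1}. \<alpha> \<gamma> * (fst \<gamma> ^ nat (int (Suc i) - s) * snd \<gamma> ^ 0) * p_hor R s))" for \<gamma>
    unfolding horizontal_defect_def right_diff_distrib left_diff_distrib distrib_left distrib_right
      sum_distrib_left sum_distrib_right
    by (intro arg_cong2[of _ _ _ _ "(-)"] arg_cong2[of _ _ _ _ "(+)"] sum.cong)
      (simp_all add: nat_Suc_minus power_add mult_ac del: of_nat_Suc)
  show ?thesis
    unfolding eq
    by (intro has_sum_diff has_sum_add has_sum_finite_sum has_sum_cmult_left has_sum_geometric_sum assms) auto
qed

lemma has_sum_vertical_defect:
  assumes "A \<subseteq> unit_square" "\<alpha> summable_on A"
  shows "((\<lambda>\<gamma>. \<alpha> \<gamma> * vertical_defect R \<gamma> * snd \<gamma> ^ j) has_sum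
    geometric_sum \<alpha> A (0, Suc j) -
      ((\<Sum>t\<in>{-1..1}. geometric_sum \<alpha> A (1, nat (int (Suc j) - t)) * p_int R (-1) t) +
       (\<Sum>t\<in>{-1..1}. geometric_sum \<alpha> A (0, nat (int (Suc j) - t)) * p_ver R t))) A"
proof -
  have eq: "\<alpha> \<gamma> * vertical_defect R \<gamma> * snd \<gamma> ^ j =
      \<alpha> \<gamma> * (fst \<gamma> ^ 0 * snd \<gamma> ^ Suc j) -
      ((\<Sum>t\<in>{-1..1}. \<alpha> \<gamma> * (fst \<gamma> ^ 1 * snd \<gamma> ^ nat (int (Suc j) - t)) * p_int R (-1) t) +
       (\<Sum>t\<in>{-1..1}. \<alpha> \<gamma> * (fst \<gamma> ^ 0 * snd \<gamma> ^ nat (int (Suc j) - t)) * p_ver R t))" for \<gamma>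
    unfolding vertical_defect_def right_diff_distrib left_diff_distrib distrib_left distrib_right
      sum_distrib_left sum_distrib_right
    by (intro arg_cong2[of _ _ _ _ "(-)"] arg_cong2[of _ _ _ _ "(+)"] sum.cong)
      (simp_all add: nat_Suc_minus power_add mult_ac del: of_nat_Suc)
  show ?thesis
    unfolding eq
    by (intro has_sum_diff has_sum_add has_sum_finite_sum has_sum_cmult_left has_sum_geometric_sum assms) auto
qed

lemma all_pos_iff_all_Suc: "(\<forall>n>0. P n) \<longleftrightarrow> (\<forall>n. P (Suc n))"
  by (metis gr0_conv_Suc)

text \<open>Balance is linear in the measure, so it becomes the vanishing of moments: in both
  variables for the interior, in one variable for each axis. This is the input of the fibre
  argument.\<close>

lemma balance_equations_geometric_sum_iff:
  assumes "A \<subseteq> unit_square" "\<alpha> summable_on A"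
  shows "balance_equations R (geometric_sum \<alpha> A) \<longleftrightarrow>
    (\<forall>i j. (\<Sum>\<^sub>\<infinity>\<gamma>\<in>A. \<alpha> \<gamma> * interior_defect R \<gamma> * (fst \<gamma> ^ i * snd \<gamma> ^ j)) = 0) \<and>
    (\<forall>i. (\<Sum>\<^sub>\<infinity>\<gamma>\<in>A. \<alpha> \<gamma> * horizontal_defect R \<gamma> * fst \<gamma> ^ i) = 0) \<and>
    (\<forall>j. (\<Sum>\<^sub>\<infinity>\<gamma>\<in>A. \<alpha> \<gamma> * vertical_defect R \<gamma> * snd \<gamma> ^ j) = 0)"
  unfolding balance_equations_def all_pos_iff_all_Suc
    infsumI[OF has_sum_interior_defect[OF assms]] infsumI[OF has_sum_horizontal_defect[OF assms]]
    infsumI[OF has_sum_vertical_defect[OF assms]] right_minus_eq ..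

text \<open>The weight is the sum of \<open>\<rho>^i * \<sigma>^j\<close> over all states, so the
  hypothesis is absolute summability over terms and states jointly. The weight is at least 1, whence
  \<alpha> itself is summable.\<close>

lemma geometric_sum_summable:
  assumes sub: "A \<subseteq> unit_square"
    and sum: "(\<lambda>\<gamma>. \<bar>\<alpha> \<gamma>\<bar> * (1 / (1 - fst \<gamma>)) * (1 / (1 - snd \<gamma>))) summable_on A"
  shows "\<alpha> summable_on A" and "geometric_sum \<alpha> A summable_on UNIV"
proof -
  show "\<alpha> summable_on A"
  proof (rule abs_summable_summable, rule Infinite_Sum.abs_summable_on_comparison_test'[OF sum])
    fix \<gamma> assume "\<gamma> \<in> A"
    then have \<gamma>: "0 < fst \<gamma>" "fst \<gamma> < 1" "0 < snd \<gamma>" "snd \<gamma> < 1"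
      using sub by (auto simp: unit_square_def)
    have "\<bar>\<alpha> \<gamma>\<bar> * 1 * 1 \<le> \<bar>\<alpha> \<gamma>\<bar> * (1 / (1 - fst \<gamma>)) * (1 / (1 - snd \<gamma>))"
      using \<gamma> by (intro mult_mono) (auto simp: field_simps)
    then show "norm (\<alpha> \<gamma>) \<le> \<bar>\<alpha> \<gamma>\<bar> * (1 / (1 - fst \<gamma>)) * (1 / (1 - snd \<gamma>))" by simp
  qed
  have geo: "((\<lambda>n. x ^ n) has_sum (1 / (1 - x))) UNIV" if "0 < x" "x < 1" for x :: real
    using that by (intro sums_nonneg_imp_has_sum geometric_sums) auto
  have abs: "(\<lambda>(\<gamma>, p). \<bar>\<alpha> \<gamma>\<bar> * (fst \<gamma> ^ fst p * snd \<gamma> ^ snd p)) summable_on A \<times> (UNIV :: state set)"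
  proof (rule summable_on_SigmaI[OF _ sum])
    fix \<gamma> assume "\<gamma> \<in> A"
    then have \<gamma>: "0 < fst \<gamma>" "fst \<gamma> < 1" "0 < snd \<gamma>" "snd \<gamma> < 1"
      using sub by (auto simp: unit_square_def)
    have inner: "((\<lambda>j. fst \<gamma> ^ i * snd \<gamma> ^ j) has_sum fst \<gamma> ^ i * (1 / (1 - snd \<gamma>))) UNIV" for i
      by (intro has_sum_cmult_right geo \<gamma>)
    have outer: "((\<lambda>i. fst \<gamma> ^ i * (1 / (1 - snd \<gamma>))) has_sum (1 / (1 - fst \<gamma>)) * (1 / (1 - snd \<gamma>))) UNIV"
      by (intro has_sum_cmult_left geo \<gamma>)
    have "(\<lambda>p. fst \<gamma> ^ fst p * snd \<gamma> ^ snd p) summable_on (UNIV :: nat set) \<times> (UNIV :: nat set)"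
      by (rule summable_on_SigmaI[where g = "\<lambda>i. fst \<gamma> ^ i * (1 / (1 - snd \<gamma>))"])
        (use inner has_sum_imp_summable[OF outer] \<gamma> in auto)
    then have "((\<lambda>p. fst \<gamma> ^ fst p * snd \<gamma> ^ snd p) has_sum (1 / (1 - fst \<gamma>)) * (1 / (1 - snd \<gamma>)))
        ((UNIV :: nat set) \<times> (UNIV :: nat set))"
      by (intro has_sum_SigmaI[OF _ outer]) (use inner in auto)
    from has_sum_cmult_right[OF this, of "\<bar>\<alpha> \<gamma>\<bar>"]
    show "((\<lambda>p. case (\<gamma>, p) of (\<gamma>, p) \<Rightarrow> \<bar>\<alpha> \<gamma>\<bar> * (fst \<gamma> ^ fst p * snd \<gamma> ^ snd p)) has_sum
        \<bar>\<alpha> \<gamma>\<bar> * (1 / (1 - fst \<gamma>)) * (1 / (1 - snd \<gamma>))) UNIV"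
      by (simp add: mult.assoc)
  next
    fix \<gamma> p assume "\<gamma> \<in> A"
    then have "0 < fst \<gamma>" "0 < snd \<gamma>"
      using sub by (auto simp: unit_square_def)
    then show "0 \<le> (case (\<gamma>, p) of (\<gamma>, p) \<Rightarrow> \<bar>\<alpha> \<gamma>\<bar> * (fst \<gamma> ^ fst p * snd \<gamma> ^ snd p))"
      by simp
  qed
  have "(\<lambda>(\<gamma>, p). \<alpha> \<gamma> * (fst \<gamma> ^ fst p * snd \<gamma> ^ snd p)) summable_on A \<times> (UNIV :: state set)"
    (is "?f summable_on ?S")
  proof -
    have cong: "norm (?f z) = (case z of (\<gamma>, p) \<Rightarrow> \<bar>\<alpha> \<gamma>\<bar> * (fst \<gamma> ^ fst p * snd \<gamma> ^ snd p))"
      if "z \<in> ?S" for z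
      using that sub by (cases z) (auto simp: unit_square_def abs_mult dest!: subsetD)
    have "(\<lambda>z. norm (?f z)) summable_on ?S"
      by (rule iffD2[OF summable_on_cong abs]) (rule cong)
    then show ?thesis by (rule abs_summable_summable)
  qed
  then have "(\<lambda>(p, \<gamma>). \<alpha> \<gamma> * (fst \<gamma> ^ fst p * snd \<gamma> ^ snd p)) summable_on (UNIV :: state set) \<times> A"
    by (subst summable_on_swap) (simp add: case_prod_unfold)
  from summable_on_Sigma_banach[OF this]
  show "geometric_sum \<alpha> A summable_on UNIV"
    by (simp add: geometric_sum_def case_prod_unfold)
qed


section \<open>Coupling classes of the terms\<close>

lemma induced_measure_geometric_sum:
  assumes "induced_measure \<Gamma> \<alpha> m"
  shows "m = geometric_sum \<alpha> \<Gamma>"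
    and "(\<lambda>\<gamma>. \<bar>\<alpha> \<gamma>\<bar> * (1 / (1 - fst \<gamma>)) * (1 / (1 - snd \<gamma>))) summable_on \<Gamma>"
  using assms
  by (auto simp: induced_measure_def geometric_sum_def fun_eq_iff case_prod_unfold mult.assoc)

text \<open>Consequently a class is a union of full fibres of \<open>fst\<close> in \<Gamma>, and
  also of \<open>snd\<close>.\<close>

lemma maximal_uncoupled_partition_saturated:
  assumes "C \<in> maximal_uncoupled_partition \<Gamma>"
  shows "C \<subseteq> \<Gamma>" and "C \<noteq> {}"
    and "a \<in> C \<Longrightarrow> b \<in> \<Gamma> \<Longrightarrow> fst b = fst a \<or> snd b = snd a \<Longrightarrow> b \<in> C"
proof -
  have part: "partition_on \<Gamma> (maximal_uncoupled_partition \<Gamma>)"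
    using uncoupled_maximal by (simp add: uncoupled_partition_def)
  show "C \<subseteq> \<Gamma>" "C \<noteq> {}"
    using part assms by (auto simp: partition_on_def)
  assume ab: "a \<in> C" "b \<in> \<Gamma>" "fst b = fst a \<or> snd b = snd a"
  obtain B where "B \<in> maximal_uncoupled_partition \<Gamma>" "b \<in> B"
    using part ab(2) by (auto simp: partition_on_def)
  then show "b \<in> C"
    using coupled_same_class[OF assms, of B a b] ab by auto
qed

lemma saturated_sum_eq_0:
  fixes b h :: "real \<times> real \<Rightarrow> real"
  assumes sum: "b summable_on \<Gamma>"
    and h: "\<And>\<gamma>. \<gamma> \<in> \<Gamma> \<Longrightarrow> 0 \<le> h \<gamma> \<and> h \<gamma> \<le> 1"
    and mom: "\<And>k. (\<Sum>\<^sub>\<infinity>\<gamma>\<in>\<Gamma>. b \<gamma> * h \<gamma> ^ k) = 0"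
    and C: "C \<subseteq> \<Gamma>" "\<And>a c. a \<in> C \<Longrightarrow> c \<in> \<Gamma> \<Longrightarrow> h c = h a \<Longrightarrow> c \<in> C"
  shows "(\<Sum>\<^sub>\<infinity>\<gamma>\<in>C. b \<gamma> * h \<gamma> ^ k) = 0"
proof (rule infsum_eq_0_if_fibre_sums_eq_0[where h = h])
  show "(\<lambda>\<gamma>. b \<gamma> * h \<gamma> ^ k) summable_on C"
    by (rule summable_on_times_bounded[where C = 1])
      (use summable_on_subset_banach[OF sum C(1)] h C(1) in \<open>auto simp: power_abs intro!: power_le_one\<close>)
  fix a assume a: "a \<in> C"
  have fibre: "{x \<in> C. h x = h a} = {x \<in> \<Gamma>. h x = h a}"
    using C a by blast
  have "(\<Sum>\<^sub>\<infinity>x\<in>{x \<in> C. h x = h a}. b x * h x ^ k) = (\<Sum>\<^sub>\<infinity>x\<in>{x \<in> \<Gamma>. h x = h a}. b x * h a ^ k)"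
    unfolding fibre by (rule infsum_cong) simp
  also have "\<dots> = (\<Sum>\<^sub>\<infinity>x\<in>{x \<in> \<Gamma>. h x = h a}. b x) * h a ^ k"
    by (rule infsum_cmult_left')
  also have "\<dots> = 0"
    using fibre_sum_eq_0[OF sum h mom, of "h a"] h[of a] a C(1) by fastforce
  finally show "(\<Sum>\<^sub>\<infinity>x\<in>{x \<in> C. h x = h a}. b x * h x ^ k) = 0" .
qed

text \<open>The coefficients \<open>\<alpha> \<gamma> * interior_defect R \<gamma>\<close> have
  vanishing moments, hence are 0 by independence. By \<open>interior_defect_eq\<close> this places
  \<gamma> on the curve.\<close>

lemma interior_defect_eq_0:
  assumes sub: "\<Gamma> \<subseteq> unit_square" and sep: "monomially_separated \<Gamma>"
    and sum: "\<alpha> summable_on \<Gamma>" and nz: "\<alpha> \<gamma> \<noteq> 0" and \<gamma>: "\<gamma> \<in> \<Gamma>"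
    and bal: "balance_equations R (geometric_sum \<alpha> \<Gamma>)"
  shows "interior_defect R \<gamma> = 0"
proof -
  have "(\<lambda>\<gamma>. \<alpha> \<gamma> * interior_defect R \<gamma>) summable_on \<Gamma>"
    using has_sum_imp_summable[OF has_sum_interior_defect[OF sub sum, of R 0 0]] by simp
  moreover have "(\<Sum>\<^sub>\<infinity>\<gamma>\<in>\<Gamma>. \<alpha> \<gamma> * interior_defect R \<gamma> * (fst \<gamma> ^ i * snd \<gamma> ^ j)) = 0" for i j
    using bal unfolding balance_equations_geometric_sum_iff[OF sub sum] by blast
  ultimately have "\<alpha> \<gamma> * interior_defect R \<gamma> = 0"
    using monomially_separated_independent[OF sep sub, of "\<lambda>\<gamma>. \<alpha> \<gamma> * interior_defect R \<gamma>"] \<gamma> by blast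
  then show ?thesis using nz by simp
qed

text \<open>The interior equations hold term by term, the axis equations on every set saturated for
  \<open>fst\<close> or \<open>snd\<close> respectively. A class is saturated for both.\<close>

lemma balance_equations_coupling_class:
  assumes sub: "\<Gamma> \<subseteq> unit_square" and sep: "monomially_separated \<Gamma>"
    and sum: "\<alpha> summable_on \<Gamma>" and nz: "\<And>\<gamma>. \<gamma> \<in> \<Gamma> \<Longrightarrow> \<alpha> \<gamma> \<noteq> 0"
    and bal: "balance_equations R (geometric_sum \<alpha> \<Gamma>)"
    and C: "C \<in> maximal_uncoupled_partition \<Gamma>"
  shows "balance_equations R (geometric_sum \<alpha> C)"
proof -
  note sat = maximal_uncoupled_partition_saturated[OF C]
  have subC: "C \<subseteq> unit_square" using sat(1) sub by blast
  have sumC: "\<alpha> summable_on C" using sum sat(1) by (rule summable_on_subset_banach)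
  have unit: "0 \<le> fst \<gamma> \<and> fst \<gamma> \<le> 1" "0 \<le> snd \<gamma> \<and> snd \<gamma> \<le> 1" if "\<gamma> \<in> \<Gamma>" for \<gamma>
    using that sub by (auto simp: unit_square_def)
  have "(\<Sum>\<^sub>\<infinity>\<gamma>\<in>C. \<alpha> \<gamma> * interior_defect R \<gamma> * (fst \<gamma> ^ i * snd \<gamma> ^ j)) = 0" for i j
  proof (rule infsum_0)
    fix \<gamma> assume "\<gamma> \<in> C"
    then have "\<gamma> \<in> \<Gamma>" using sat(1) by blast
    from interior_defect_eq_0[OF sub sep sum nz[OF this] this bal]
    show "\<alpha> \<gamma> * interior_defect R \<gamma> * (fst \<gamma> ^ i * snd \<gamma> ^ j) = 0" by simp
  qed
  moreover have "(\<Sum>\<^sub>\<infinity>\<gamma>\<in>C. \<alpha> \<gamma> * horizontal_defect R \<gamma> * fst \<gamma> ^ i) = 0" for i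
  proof (rule saturated_sum_eq_0[of _ \<Gamma> fst])
    show "(\<lambda>\<gamma>. \<alpha> \<gamma> * horizontal_defect R \<gamma>) summable_on \<Gamma>"
      using has_sum_imp_summable[OF has_sum_horizontal_defect[OF sub sum, of R 0]] by simp
    show "(\<Sum>\<^sub>\<infinity>\<gamma>\<in>\<Gamma>. \<alpha> \<gamma> * horizontal_defect R \<gamma> * fst \<gamma> ^ k) = 0" for k
      using bal unfolding balance_equations_geometric_sum_iff[OF sub sum] by blast
  qed (use unit sat in blast)+
  moreover have "(\<Sum>\<^sub>\<infinity>\<gamma>\<in>C. \<alpha> \<gamma> * vertical_defect R \<gamma> * snd \<gamma> ^ j) = 0" for j
  proof (rule saturated_sum_eq_0[of _ \<Gamma> snd])
    show "(\<lambda>\<gamma>. \<alpha> \<gamma> * vertical_defect R \<gamma>) summable_on \<Gamma>"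
      using has_sum_imp_summable[OF has_sum_vertical_defect[OF sub sum, of R 0]] by simp
    show "(\<Sum>\<^sub>\<infinity>\<gamma>\<in>\<Gamma>. \<alpha> \<gamma> * vertical_defect R \<gamma> * snd \<gamma> ^ k) = 0" for k
      using bal unfolding balance_equations_geometric_sum_iff[OF sub sum] by blast
  qed (use unit sat in blast)+
  ultimately show ?thesis
    unfolding balance_equations_geometric_sum_iff[OF subC sumC] by blast
qed

text \<open>Uniqueness up to scaling among finite signed solutions: \<open>c\<close> is chosen so
  that the signed invariant measure \<open>\<nu> - c * m\<close> has a zero at \<open>x0\<close>,
  and one zero forces it to vanish.\<close>

lemma proportional_to_invariant_measure:
  fixes \<nu> m :: "state \<Rightarrow> real"
  assumes hom: "homogeneous_walk R" and irr: "irreducible_chain R"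
    and m: "invariant_measure R m"
    and bal: "balance_equations R \<nu>" and sum: "\<nu> summable_on UNIV"
  obtains c where "\<And>x. \<nu> x = c * m x"
proof -
  have sm: "m summable_on UNIV" and bm: "balance_equations R m"
    using m by (simp_all add: invariant_measure_def)
  note inv_m = invariant_if_balance_equations[OF hom bm sm]
  note inv_\<nu> = invariant_if_balance_equations[OF hom bal sum]
  obtain x0 where "m x0 > 0" using m by (auto simp: invariant_measure_def)
  define c where "c = \<nu> x0 / m x0"
  have scm: "(\<lambda>x. c * m x) summable_on UNIV"
    using sm by (rule summable_on_cmult_right)
  have "((\<lambda>x. \<nu> x * pmf (R x) y - c * (m x * pmf (R x) y)) has_sum \<nu> y - c * m y) UNIV" for y
  proof (intro has_sum_diff has_sum_cmult_right)
    show "((\<lambda>x. \<nu> x * pmf (R x) y) has_sum \<nu> y) UNIV"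
      using summable_on_kernel_image_summand[OF sum] inv_\<nu>[of y, symmetric] by (simp add: has_sum_iff)
    show "((\<lambda>x. m x * pmf (R x) y) has_sum m y) UNIV"
      using summable_on_kernel_image_summand[OF sm] inv_m[of y, symmetric] by (simp add: has_sum_iff)
  qed
  then have inv: "\<nu> y - c * m y = (\<Sum>\<^sub>\<infinity>x. (\<nu> x - c * m x) * pmf (R x) y)" for y
    by (simp add: has_sum_iff left_diff_distrib mult.assoc)
  have zero: "\<nu> x0 - c * m x0 = 0" using \<open>m x0 > 0\<close> by (simp add: c_def)
  have "(\<lambda>x. \<nu> x - c * m x) summable_on UNIV"
    by (rule has_sum_imp_summable[OF has_sum_diff[OF has_sum_infsum[OF sum] has_sum_infsum[OF scm]]])
  from signed_invariant_eq_0[OF irr this inv zero]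
  have "\<nu> x = c * m x" for x unfolding eq_iff_diff_eq_0[of "\<nu> x"] .
  then show ?thesis by (rule that)
qed

lemma maximal_uncoupled_partition_trivial:
  assumes hom: "homogeneous_walk R" and irr: "irreducible_chain R"
    and sub: "\<Gamma> \<subseteq> unit_square" and sep: "monomially_separated \<Gamma>"
    and ind: "induced_measure \<Gamma> \<alpha> m" and m: "invariant_measure R m"
    and C: "C \<in> maximal_uncoupled_partition \<Gamma>"
  shows "C = \<Gamma>"
proof -
  note sat = maximal_uncoupled_partition_saturated[OF C]
  have nz: "\<alpha> \<gamma> \<noteq> 0" if "\<gamma> \<in> \<Gamma>" for \<gamma>
    using ind that by (simp add: induced_measure_def)
  note geo = induced_measure_geometric_sum[OF ind]
  have sum: "\<alpha> summable_on \<Gamma>" by (rule geometric_sum_summable[OF sub geo(2)])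
  have subC: "C \<subseteq> unit_square" using sat(1) sub by blast
  have sumC: "\<alpha> summable_on C" using sum sat(1) by (rule summable_on_subset_banach)
  have bal: "balance_equations R (geometric_sum \<alpha> C)"
    using balance_equations_coupling_class[OF sub sep sum nz _ C] m geo(1)
    by (simp add: invariant_measure_def)
  have "geometric_sum \<alpha> C summable_on UNIV"
    by (rule geometric_sum_summable[OF subC summable_on_subset_banach[OF geo(2) sat(1)]])
  from proportional_to_invariant_measure[OF hom irr m bal this]
  obtain c where c: "\<And>x. geometric_sum \<alpha> C x = c * m x" by blast
  \<comment> \<open>The coefficients of the zero measure
    \<open>geometric_sum \<alpha> C - c * m\<close>, written as a combination over all of
    \<Gamma>.\<close>
  define b where "b \<gamma> = (if \<gamma> \<in> C then \<alpha> \<gamma> else 0) - c * \<alpha> \<gamma>" for \<gamma>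
  have b: "((\<lambda>\<gamma>. b \<gamma> * (fst \<gamma> ^ i * snd \<gamma> ^ j)) has_sum 0) \<Gamma>" for i j
  proof -
    have "((\<lambda>\<gamma>. (if \<gamma> \<in> C then \<alpha> \<gamma> else 0) * (fst \<gamma> ^ i * snd \<gamma> ^ j)) has_sum
        geometric_sum \<alpha> C (i, j)) \<Gamma> \<longleftrightarrow>
      ((\<lambda>\<gamma>. \<alpha> \<gamma> * (fst \<gamma> ^ i * snd \<gamma> ^ j)) has_sum geometric_sum \<alpha> C (i, j)) C"
      using sat(1) by (intro has_sum_cong_neutral) auto
    then have "((\<lambda>\<gamma>. (if \<gamma> \<in> C then \<alpha> \<gamma> else 0) * (fst \<gamma> ^ i * snd \<gamma> ^ j) -
        c * (\<alpha> \<gamma> * (fst \<gamma> ^ i * snd \<gamma> ^ j))) has_sum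
        geometric_sum \<alpha> C (i, j) - c * geometric_sum \<alpha> \<Gamma> (i, j)) \<Gamma>"
      using has_sum_geometric_sum[OF subC sumC] has_sum_geometric_sum[OF sub sum]
      by (intro has_sum_diff has_sum_cmult_right) auto
    then show ?thesis
      using c[of "(i, j)"] geo(1) by (simp add: b_def left_diff_distrib mult.assoc)
  qed
  have "b summable_on \<Gamma>" using has_sum_imp_summable[OF b[of 0 0]] by simp
  from monomially_separated_independent[OF sep sub this infsumI[OF b]]
  have b0: "b \<gamma> = 0" if "\<gamma> \<in> \<Gamma>" for \<gamma> using that by blast
  \<comment> \<open>A point of \<open>C\<close> forces \<open>c = 1\<close>; a point of \<Gamma>
    outside \<open>C\<close> would then have coefficient 0, contrary to \<open>nz\<close>.\<close>
  obtain \<gamma>0 where "\<gamma>0 \<in> C" using sat(2) by blast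
  then have "\<alpha> \<gamma>0 = c * \<alpha> \<gamma>0" "\<alpha> \<gamma>0 \<noteq> 0"
    using b0[of \<gamma>0] nz[of \<gamma>0] sat(1) by (auto simp: b_def)
  then have "c = 1" by simp
  then have "\<gamma> \<in> C" if "\<gamma> \<in> \<Gamma>" for \<gamma>
    using b0[OF that] nz[OF that] by (auto simp: b_def split: if_splits)
  then show ?thesis using sat(1) by blast
qed

theorem theorem19:
  fixes R :: walk and \<Gamma> :: "(real \<times> real) set"
    and \<alpha> :: "real \<times> real \<Rightarrow> real" and m :: "state \<Rightarrow> real"
  assumes "homogeneous_walk R"
    and "\<not> singular_walk R"
    and "irreducible_chain R"
    and "aperiodic_chain R"
    and "positive_recurrent_chain R"
    and "\<Gamma> \<subseteq> unit_square"
    and "infinite \<Gamma>"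
    and "monomially_separated \<Gamma>"
    and "induced_measure \<Gamma> \<alpha> m"
    and "invariant_measure R m"
  shows "(\<forall>C \<in> maximal_uncoupled_partition \<Gamma>. infinite C)
    \<and> finite (maximal_uncoupled_partition \<Gamma>)
    \<and> (\<exists>F. finite F \<and> \<Union>F = \<Gamma> \<and>
          (\<forall>C\<in>F. pairwise_coupled R C \<and> countable C \<and> infinite C))"
proof -
  note ind = \<open>induced_measure \<Gamma> \<alpha> m\<close>
  note sub = \<open>\<Gamma> \<subseteq> unit_square\<close>
  note geo = induced_measure_geometric_sum[OF ind]
  have sum: "\<alpha> summable_on \<Gamma>" by (rule geometric_sum_summable[OF sub geo(2)])
  have nz: "\<alpha> \<gamma> \<noteq> 0" if "\<gamma> \<in> \<Gamma>" for \<gamma>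
    using ind that by (simp add: induced_measure_def)
  have bal: "balance_equations R (geometric_sum \<alpha> \<Gamma>)"
    using \<open>invariant_measure R m\<close> geo(1) by (simp add: invariant_measure_def)
  have single: "maximal_uncoupled_partition \<Gamma> = {\<Gamma>}"
  proof -
    have "C = \<Gamma>" if "C \<in> maximal_uncoupled_partition \<Gamma>" for C
      using maximal_uncoupled_partition_trivial that assms by blast
    moreover have "\<Union>(maximal_uncoupled_partition \<Gamma>) = \<Gamma>"
      using uncoupled_maximal by (auto simp: uncoupled_partition_def partition_on_def)
    moreover have "\<Gamma> \<noteq> {}" using \<open>infinite \<Gamma>\<close> by auto
    ultimately show ?thesis by blast
  qed
  have "\<Gamma> \<subseteq> curve_unit R"
  proof
    fix \<gamma> assume \<gamma>: "\<gamma> \<in> \<Gamma>"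
    have "eval2 (kernel_poly R) (fst \<gamma>) (snd \<gamma>) = 0"
      using interior_defect_eq_0[OF sub \<open>monomially_separated \<Gamma>\<close> sum nz[OF \<gamma>] \<gamma> bal]
      by (simp add: interior_defect_eq)
    then show "\<gamma> \<in> curve_unit R"
      using \<gamma> sub by (auto simp: curve_unit_def curve_nonneg_def curve_def unit_square_def)
  qed
  then have "pairwise_coupled R \<Gamma>" using single by (simp add: pairwise_coupled_def)
  moreover have "countable \<Gamma>"
  proof -
    \<comment> \<open>A summable real family has countable support, and the support of \<alpha> is
      all of \<Gamma>.\<close>
    have "countable {\<gamma> \<in> \<Gamma>. \<alpha> \<gamma> \<noteq> 0}" using sum by (rule summable_countable_real)
    moreover have "{\<gamma> \<in> \<Gamma>. \<alpha> \<gamma> \<noteq> 0} = \<Gamma>" using nz by blast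
    ultimately show ?thesis by simp
  qed
  ultimately have "\<forall>C\<in>{\<Gamma>}. pairwise_coupled R C \<and> countable C \<and> infinite C"
    using \<open>infinite \<Gamma>\<close> by simp
  then show ?thesis
    using single \<open>infinite \<Gamma>\<close> by (intro conjI exI[of _ "{\<Gamma>}"]) auto
qed

end
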